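(* $MA_{\omega_1}$ implies that every point of a compact $T_2$ space of countable spread has a disjoint local $\pi$-base.
   Context: $T_2$ means Hausdorff. $MA_{\omega_1}$ is Martin's Axiom for $\omega_1$ dense sets: for every ccc partial order and every family of at most $\omega_1$ dense subsets of it there is a filter meeting all of them. A space has countable spread if each of its discrete subspaces is countable. A local $\pi$-base at a point $p$ of a space $X$ is a family $\mathcal{B}$ of non-empty open subsets of $X$ such that every neighborhood of $p$ includes a member of $\mathcal{B}$; it is disjoint if its members are pairwise disjoint. *)

theory Defs
  imports "HOL-Analysis.Analysis"
begin

unbundle cardinal_syntax

text \<open>
  A partial order is a carrier \<open>P\<close> with a relation \<open>r\<close>; \<open>(p, q) \<in> r\<close> means that \<open>p\<close> extends
  \<open>q\<close> (\<open>p \<le> q\<close>), so dense sets and filters are taken in the downward (forcing) convention.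
\<close>

definition compatible_in :: "'p set \<Rightarrow> 'p rel \<Rightarrow> 'p \<Rightarrow> 'p \<Rightarrow> bool" where
  "compatible_in P r p q \<longleftrightarrow> (\<exists>s\<in>P. (s, p) \<in> r \<and> (s, q) \<in> r)"

definition ccc_order :: "'p set \<Rightarrow> 'p rel \<Rightarrow> bool" where
  "ccc_order P r \<longleftrightarrow>
     (\<forall>A\<subseteq>P. pairwise (\<lambda>p q. \<not> compatible_in P r p q) A \<longrightarrow> countable A)"

definition dense_subset :: "'p set \<Rightarrow> 'p rel \<Rightarrow> 'p set \<Rightarrow> bool" where
  "dense_subset P r D \<longleftrightarrow> D \<subseteq> P \<and> (\<forall>p\<in>P. \<exists>d\<in>D. (d, p) \<in> r)"

definition order_filter :: "'p set \<Rightarrow> 'p rel \<Rightarrow> 'p set \<Rightarrow> bool" where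
  "order_filter P r G \<longleftrightarrow> G \<subseteq> P \<and> G \<noteq> {} \<and>
     (\<forall>p\<in>G. \<forall>q\<in>P. (p, q) \<in> r \<longrightarrow> q \<in> G) \<and>
     (\<forall>p\<in>G. \<forall>q\<in>G. \<exists>s\<in>G. (s, p) \<in> r \<and> (s, q) \<in> r)"

text \<open>
  Martin's Axiom for the partial orders carried by a subset of the type \<open>'p\<close>. Filters are
  non-empty, so the carrier has to be assumed non-empty. The cardinal \<open>cardSuc natLeq\<close> is
  \<open>\<omega>\<^sub>1\<close>.
\<close>

definition MA_omega1_on :: "'p itself \<Rightarrow> bool" where
  "MA_omega1_on _ \<longleftrightarrow>
     (\<forall>(P :: 'p set) r \<D>.
        P \<noteq> {} \<and> partial_order_on P r \<and> ccc_order P r \<and>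
        |\<D>| \<le>o cardSuc natLeq \<and> (\<forall>D\<in>\<D>. dense_subset P r D) \<longrightarrow>
        (\<exists>G. order_filter P r G \<and> (\<forall>D\<in>\<D>. G \<inter> D \<noteq> {})))"

text \<open>
  A formula cannot quantify over types, so one type has to carry the partial orders. Any type of
  cardinality at least \<open>\<omega>\<^sub>1\<close> gives the same axiom: theorem \<open>MA_omega1_imp_MA_omega1_on\<close> below
  derives from \<open>MA_omega1\<close> the axiom for the partial orders on an arbitrary type.
\<close>

definition MA_omega1 :: bool where
  "MA_omega1 \<longleftrightarrow> MA_omega1_on TYPE(nat set)"

definition countable_spread :: "'a topology \<Rightarrow> bool" where
  "countable_spread X \<longleftrightarrow>
     (\<forall>D\<subseteq>topspace X. subtopology X D = discrete_topology D \<longrightarrow> countable D)"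

definition local_pi_base :: "'a topology \<Rightarrow> 'a \<Rightarrow> 'a set set \<Rightarrow> bool" where
  "local_pi_base X p \<B> \<longleftrightarrow>
     (\<forall>B\<in>\<B>. openin X B \<and> B \<noteq> {}) \<and>
     (\<forall>N\<subseteq>topspace X. (\<exists>U. openin X U \<and> p \<in> U \<and> U \<subseteq> N) \<longrightarrow> (\<exists>B\<in>\<B>. B \<subseteq> N))"

lemma Card_order_omega1: "Card_order (cardSuc natLeq)"
  by (simp add: cardSuc_Card_order natLeq_Card_order)

lemma nat_ordLeq_omega1: "|UNIV :: nat set| \<le>o cardSuc natLeq"
  by (rule ordIso_ordLeq_trans[OF card_of_nat cardSuc_ordLeq[OF natLeq_Card_order]])

lemma ordLeq_omega1_Field: "|A| \<le>o |Field (cardSuc natLeq)|" if "|A| \<le>o cardSuc natLeq"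
  using that card_of_Field_ordIso[OF Card_order_omega1] ordIso_symmetric ordLeq_ordIso_trans
  by blast

lemma infinite_Field_omega1: "\<not> finite (Field (cardSuc natLeq))"
  using card_of_ordLeq_infinite[OF ordLeq_omega1_Field[OF nat_ordLeq_omega1]] by simp

text \<open>Every partial order has a suborder of size at most \<open>\<omega>\<^sub>1\<close> that is closed under given
  witnesses for compatibility and for density.\<close>

lemma omega1_closure:
  fixes d :: "'i \<Rightarrow> 'p \<Rightarrow> 'p" and c :: "'p \<Rightarrow> 'p \<Rightarrow> 'p"
  assumes I: "|I| \<le>o cardSuc natLeq" and "p0 \<in> P"
    and d: "\<And>i p. i \<in> I \<Longrightarrow> p \<in> P \<Longrightarrow> d i p \<in> P"
    and c: "\<And>p q. p \<in> P \<Longrightarrow> q \<in> P \<Longrightarrow> c p q \<in> P"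
  obtains Q where "p0 \<in> Q" "Q \<subseteq> P" "|Q| \<le>o cardSuc natLeq"
    "\<And>i p. i \<in> I \<Longrightarrow> p \<in> Q \<Longrightarrow> d i p \<in> Q"
    "\<And>p q. p \<in> Q \<Longrightarrow> q \<in> Q \<Longrightarrow> c p q \<in> Q"
proof -
  define F where "F S = S \<union> case_prod d ` (I \<times> S) \<union> case_prod c ` (S \<times> S)" for S
  define Q where "Q n = (F ^^ n) {p0}" for n
  have Q0: "Q 0 = {p0}" and QS: "Q (Suc n) = F (Q n)" for n
    by (simp_all add: Q_def)
  have sub: "Q n \<subseteq> P" for n
  proof (induction n)
    case 0
    show ?case using \<open>p0 \<in> P\<close> by (simp add: Q0)
  next
    case (Suc n)
    have "d i p \<in> P" if "i \<in> I" "p \<in> Q n" for i p using d that Suc by blast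
    moreover have "c p q \<in> P" if "p \<in> Q n" "q \<in> Q n" for p q using c that Suc by blast
    ultimately show ?case using Suc by (auto simp: QS F_def)
  qed
  have mono: "Q m \<subseteq> Q n" if "m \<le> n" for m n
    by (rule lift_Suc_mono_le[OF _ that]) (auto simp: QS F_def)
  have small: "|Q n| \<le>o cardSuc natLeq" for n
  proof (induction n)
    case 0
    show ?case unfolding Q0
      using ordLess_imp_ordLeq[OF finite_ordLess_infinite[OF card_of_Well_order
            Card_order_omega1[THEN card_order_on_well_order_on], of "{p0}"]] infinite_Field_omega1
      by (simp add: Field_card_of)
  next
    case (Suc n)
    note T = card_of_Times_ordLeq_infinite_Field[OF infinite_Field_omega1 _ _ Card_order_omega1]
    note U = card_of_Un_ordLeq_infinite_Field[OF infinite_Field_omega1 _ _ Card_order_omega1]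
    show ?case unfolding QS F_def
      by (intro U Suc.IH ordLeq_transitive[OF card_of_image] T I)
  qed
  show thesis
  proof (rule that[of "\<Union>n. Q n"])
    show "p0 \<in> (\<Union>n. Q n)" using Q0 by auto
    show "(\<Union>n. Q n) \<subseteq> P" using sub by auto
    show "|\<Union>n. Q n| \<le>o cardSuc natLeq"
      by (intro card_of_UNION_ordLeq_infinite_Field infinite_Field_omega1 Card_order_omega1
          nat_ordLeq_omega1 ballI small)
  next
    fix i p assume "i \<in> I" "p \<in> (\<Union>n. Q n)"
    then obtain n where "p \<in> Q n" by auto
    with \<open>i \<in> I\<close> have "d i p \<in> Q (Suc n)" by (auto simp: QS F_def)
    then show "d i p \<in> (\<Union>n. Q n)" by blast
  next
    fix p q assume "p \<in> (\<Union>n. Q n)" "q \<in> (\<Union>n. Q n)"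
    then obtain m n where "p \<in> Q m" "q \<in> Q n" by auto
    then have "p \<in> Q (max m n)" "q \<in> Q (max m n)"
      using mono by (meson max.cobounded1 max.cobounded2 subsetD)+
    then have "c p q \<in> Q (Suc (max m n))" by (auto simp: QS F_def)
    then show "c p q \<in> (\<Union>n. Q n)" by blast
  qed
qed

theorem MA_omega1_imp_MA_omega1_on:
  assumes MA_omega1
  shows "MA_omega1_on TYPE('p)"
  unfolding MA_omega1_on_def
proof (intro allI impI, elim conjE)
  fix P :: "'p set" and r \<D>
  assume ne: "P \<noteq> {}" and po: "partial_order_on P r" and ccc: "ccc_order P r"
    and small: "|\<D>| \<le>o cardSuc natLeq" and dense: "\<forall>D\<in>\<D>. dense_subset P r D"
  have rP: "r \<subseteq> P \<times> P" and refl: "\<And>p. p \<in> P \<Longrightarrow> (p, p) \<in> r" and tr: "trans r" and an: "antisym r"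
    using po by (auto simp: partial_order_on_def preorder_on_def refl_on_def)
  obtain p0 where p0: "p0 \<in> P" using ne by auto
  have "\<forall>D\<in>\<D>. \<forall>p\<in>P. \<exists>x. x \<in> D \<and> (x, p) \<in> r"
    using dense unfolding dense_subset_def by blast
  then obtain d where d: "\<And>D p. D \<in> \<D> \<Longrightarrow> p \<in> P \<Longrightarrow> d D p \<in> D \<and> (d D p, p) \<in> r"
    by metis
  have "\<forall>p\<in>P. \<forall>q\<in>P. \<exists>x. x \<in> P \<and> (compatible_in P r p q \<longrightarrow> (x, p) \<in> r \<and> (x, q) \<in> r)"
    using p0 by (auto simp: compatible_in_def)
  then obtain c where c: "\<And>p q. p \<in> P \<Longrightarrow> q \<in> P \<Longrightarrow> c p q \<in> P"
    and c': "\<And>p q. p \<in> P \<Longrightarrow> q \<in> P \<Longrightarrow> compatible_in P r p q \<Longrightarrow> (c p q, p) \<in> r \<and> (c p q, q) \<in> r"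
    by metis
  have dP: "d D p \<in> P" if "D \<in> \<D>" "p \<in> P" for D p
    using d[OF that] rP by auto
  obtain Q where Q: "p0 \<in> Q" "Q \<subseteq> P" "|Q| \<le>o cardSuc natLeq"
    "\<And>D p. D \<in> \<D> \<Longrightarrow> p \<in> Q \<Longrightarrow> d D p \<in> Q"
    "\<And>p q. p \<in> Q \<Longrightarrow> q \<in> Q \<Longrightarrow> c p q \<in> Q"
    using omega1_closure[OF small p0, of d c] dP c by blast
  obtain f :: "'p \<Rightarrow> nat set" where f: "inj_on f Q"
    using ordLeq_omega1_Field[OF Q(3)] by (meson card_of_ordLeq)
  define g where "g = the_inv_into Q f"
  have gf: "g (f q) = q" if "q \<in> Q" for q
    using f that by (simp add: g_def the_inv_into_f_f)
  define R where "R = {(f p, f q) | p q. p \<in> Q \<and> q \<in> Q \<and> (p, q) \<in> r}"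
  have R: "(f p, f q) \<in> R \<longleftrightarrow> (p, q) \<in> r" if "p \<in> Q" "q \<in> Q" for p q
    using that gf unfolding R_def by (auto, metis)
  have poR: "partial_order_on (f ` Q) R"
    unfolding partial_order_on_def preorder_on_def
  proof (intro conjI)
    show "R \<subseteq> f ` Q \<times> f ` Q" by (auto simp: R_def)
    show "refl_on (f ` Q) R" using refl Q(2) by (auto simp: refl_on_def R)
    show "trans R"
    proof (rule transI)
      fix x y z assume "(x, y) \<in> R" "(y, z) \<in> R"
      then obtain p q q' s where "x = f p" "y = f q" "y = f q'" "z = f s" "p \<in> Q" "q \<in> Q" "q' \<in> Q"
        "s \<in> Q" "(p, q) \<in> r" "(q', s) \<in> r"
        by (auto simp: R_def)
      then show "(x, z) \<in> R"
        using gf[of q] gf[of q'] by (auto simp: R intro: transD[OF tr])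
    qed
    show "antisym R"
    proof (rule antisymI)
      fix x y assume "(x, y) \<in> R" and yx: "(y, x) \<in> R"
      then obtain p q where "x = f p" "y = f q" "p \<in> Q" "q \<in> Q" "(p, q) \<in> r"
        by (auto simp: R_def)
      with yx show "x = y" by (auto simp: R dest: antisymD[OF an])
    qed
  qed
  have comp: "compatible_in (f ` Q) R (f p) (f q)"
    if "p \<in> Q" "q \<in> Q" "compatible_in P r p q" for p q
  proof -
    have "c p q \<in> Q" "(c p q, p) \<in> r" "(c p q, q) \<in> r"
      using that Q(2,5) c' by blast+
    then show ?thesis using that by (auto simp: compatible_in_def R)
  qed
  have cccR: "ccc_order (f ` Q) R"
    unfolding ccc_order_def
  proof (intro allI impI)
    fix A assume A: "A \<subseteq> f ` Q" "pairwise (\<lambda>p q. \<not> compatible_in (f ` Q) R p q) A"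
    then obtain B where B: "B \<subseteq> Q" "A = f ` B" by (auto simp: subset_image_iff)
    have "pairwise (\<lambda>p q. \<not> compatible_in P r p q) B"
      unfolding pairwise_def
    proof (intro ballI impI notI)
      fix p q assume pq: "p \<in> B" "q \<in> B" "p \<noteq> q" "compatible_in P r p q"
      then have "f p \<noteq> f q" using B(1) inj_onD[OF f, of p q] by auto
      then show False using A(2) comp[of p q] pq B by (auto simp: pairwise_def)
    qed
    then have "countable B" using ccc B(1) Q(2) unfolding ccc_order_def by blast
    then show "countable A" using B(2) by simp
  qed
  have dR: "dense_subset (f ` Q) R (f ` (D \<inter> Q))" if D: "D \<in> \<D>" for D
    unfolding dense_subset_def
  proof (intro conjI ballI)
    fix x assume "x \<in> f ` Q"
    then obtain p where p: "p \<in> Q" "x = f p" by auto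
    then have "d D p \<in> D \<inter> Q" "(d D p, p) \<in> r" using d[OF D, of p] Q(2,4) D by auto
    then show "\<exists>y\<in>f ` (D \<inter> Q). (y, x) \<in> R" using p by (auto simp: R intro!: bexI[of _ "d D p"])
  qed auto
  have "|(\<lambda>D. f ` (D \<inter> Q)) ` \<D>| \<le>o cardSuc natLeq"
    by (rule ordLeq_transitive[OF card_of_image small])
  then obtain H where H: "order_filter (f ` Q) R H" "\<forall>D\<in>\<D>. H \<inter> f ` (D \<inter> Q) \<noteq> {}"
    using assms[unfolded MA_omega1_def MA_omega1_on_def, rule_format,
        of "f ` Q" R "(\<lambda>D. f ` (D \<inter> Q)) ` \<D>"] poR cccR dR Q(1)
    by auto
  define G where "G = {p \<in> P. \<exists>q\<in>Q. f q \<in> H \<and> (q, p) \<in> r}"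
  have G1: "q \<in> G" if "q \<in> Q" "f q \<in> H" for q
    using that Q(2) refl by (auto simp: G_def)
  show "\<exists>G. order_filter P r G \<and> (\<forall>D\<in>\<D>. G \<inter> D \<noteq> {})"
  proof (intro exI[of _ G] conjI ballI)
    show "order_filter P r G"
      unfolding order_filter_def
    proof (intro conjI ballI impI)
      show "G \<subseteq> P" by (auto simp: G_def)
      show "G \<noteq> {}" using H(1) G1 unfolding order_filter_def by blast
    next
      fix p q assume "p \<in> G" "q \<in> P" "(p, q) \<in> r"
      then show "q \<in> G" by (auto simp: G_def intro: transD[OF tr])
    next
      fix p q assume "p \<in> G" "q \<in> G"
      then obtain p' q' where pq: "p' \<in> Q" "q' \<in> Q" "f p' \<in> H" "f q' \<in> H" "(p', p) \<in> r" "(q', q) \<in> r"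
        by (auto simp: G_def)
      then obtain y where y: "y \<in> H" "(y, f p') \<in> R" "(y, f q') \<in> R"
        using H(1) unfolding order_filter_def by blast
      then obtain s where s: "s \<in> Q" "y = f s"
        using H(1) unfolding order_filter_def by blast
      then have "(s, p') \<in> r" "(s, q') \<in> r" using y pq R by auto
      then have "(s, p) \<in> r" "(s, q) \<in> r" using pq tr by (meson transD)+
      then show "\<exists>s\<in>G. (s, p) \<in> r \<and> (s, q) \<in> r" using G1[OF s(1)] s y by auto
    qed
  next
    fix D assume "D \<in> \<D>"
    then show "G \<inter> D \<noteq> {}" using H(2) G1 by blast
  qed
qed

end

theory Submission
  imports Defs "HOL-Library.Countable_Set_Type"
begin

text \<open>
  The heart of the matter is that every point \<open>p\<close> is a \<open>G\<^sub>\<delta>\<close>. In a compact Hausdorff space \<open>p\<close> then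
  has a countable base \<open>V\<^sub>0 \<supseteq> cl V\<^sub>1 \<supseteq> V\<^sub>1 \<supseteq> \<dots>\<close>, and unless \<open>p\<close> is isolated the non-empty ones among
  the rings \<open>V\<^sub>n - cl V\<^sub>n\<^sub>+\<^sub>1\<close> are a disjoint local \<open>\<pi>\<close>-base
  (\<open>gdelta_point_disjoint_local_pi_base\<close>).

  That points are \<open>G\<^sub>\<delta>\<close> follows by an argument of Szentmiklossy. If \<open>p\<close> is not a \<open>G\<^sub>\<delta>\<close>, recursion
  along \<open>\<omega>\<^sub>1\<close> yields points \<open>y\<^sub>a\<close> with neighbourhoods \<open>W\<^sub>a \<subseteq> K\<^sub>a \<subseteq> U\<^sub>a\<close>, where \<open>K\<^sub>a\<close> is closed
  and \<open>U\<^sub>a\<close> is open and contains no later point \<open>y\<^sub>b\<close>. The finite sets \<open>F \<subseteq> \<omega>\<^sub>1\<close> such that no \<open>y\<^sub>a\<close>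
  with \<open>a \<in> F\<close> lies in \<open>W\<^sub>b\<close> for another \<open>b \<in> F\<close> form a partial order under reverse inclusion. If
  it is ccc, Martin's Axiom provides an uncountable set with the same property
  (\<open>MA_uncountable_indep\<close>), hence an uncountable discrete subspace, which countable spread
  forbids.

  For the ccc, an uncountable antichain can be thinned out to consecutive blocks
  \<open>F\<^sub>a\<close> of a fixed size \<open>n\<close> (\<open>uncountable_antichain_imp_blocks\<close>). Each block, read as a point \<open>z\<^sub>a\<close> of
  the power \<open>X\<^sup>n\<close>, has a coordinate in the closed set \<open>\<Union>j\<in>F\<^sub>b. K\<^sub>j\<close> when \<open>a < b\<close>, and has no
  coordinate in the larger open set \<open>\<Union>j\<in>F\<^sub>b. U\<^sub>j\<close> when \<open>a > b\<close>. So \<open>(z\<^sub>a)\<close> is an uncountable free sequence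
  in \<open>X\<^sup>n\<close>. There is none: countable spread makes \<open>X\<close> countably tight
  (\<open>countable_spread_imp_countably_tight\<close>), finite powers inherit this by Malykhin's theorem
  (\<open>countably_tight_product_topology\<close>), and countably tight compact spaces have no uncountable
  free sequences (\<open>countably_tight_no_free_sequence\<close>).
\<close>

section \<open>The first uncountable ordinal\<close>

text \<open>
  With \<open>\<omega>\<^sub>1\<close> as a type of class \<open>wellorder\<close>, recursion and induction along it are those of the
  class, and Martin's Axiom applies to orders of finite sets of type \<open>omega1 set\<close>.
\<close>

typedef omega1 = "Field (cardSuc natLeq)"
  using infinite_Field_omega1 by (metis ex_in_conv finite.emptyI)

lemma Well_order_omega1: "Well_order (cardSuc natLeq)"
  using Card_order_omega1 by (rule card_order_on_well_order_on)

instantiation omega1 :: linorder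
begin

definition less_eq_omega1 :: "omega1 \<Rightarrow> omega1 \<Rightarrow> bool" where
  "a \<le> b \<longleftrightarrow> (Rep_omega1 a, Rep_omega1 b) \<in> cardSuc natLeq"

definition less_omega1 :: "omega1 \<Rightarrow> omega1 \<Rightarrow> bool" where
  "a < (b :: omega1) \<longleftrightarrow> a \<le> b \<and> \<not> b \<le> a"

instance
proof
  have lin: "refl_on (Field (cardSuc natLeq)) (cardSuc natLeq)" "trans (cardSuc natLeq)"
    "antisym (cardSuc natLeq)" "total_on (Field (cardSuc natLeq)) (cardSuc natLeq)"
    using Well_order_omega1
    by (auto simp: well_order_on_def linear_order_on_def partial_order_on_def preorder_on_def)
  fix a b c :: omega1
  show "a < b \<longleftrightarrow> a \<le> b \<and> \<not> b \<le> a"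
    by (rule less_omega1_def)
  show "a \<le> a"
    using lin(1) Rep_omega1 by (auto simp: less_eq_omega1_def refl_on_def)
  show "a \<le> c" if "a \<le> b" "b \<le> c"
    using lin(2) that unfolding less_eq_omega1_def by (rule transD)
  show "a = b" if "a \<le> b" "b \<le> a"
    using lin(3) that unfolding less_eq_omega1_def by (metis Rep_omega1_inject antisymD)
  show "a \<le> b \<or> b \<le> a"
    using lin Rep_omega1[of a] Rep_omega1[of b] unfolding less_eq_omega1_def total_on_def refl_on_def
    by metis
qed

end

instance omega1 :: wellorder
proof
  fix P :: "omega1 \<Rightarrow> bool" and a :: omega1
  assume step: "\<And>x. (\<And>y. y < x \<Longrightarrow> P y) \<Longrightarrow> P x"
  have "wf (inv_image (cardSuc natLeq - Id) Rep_omega1)"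
    using Well_order_omega1 by (intro wf_inv_image) (simp add: well_order_on_def)
  then show "P a"
  proof (induction a rule: wf_induct_rule)
    case (less x)
    show ?case
    proof (rule step)
      fix y assume "y < x"
      then have "(y, x) \<in> inv_image (cardSuc natLeq - Id) Rep_omega1"
        by (auto simp: less_eq_omega1_def less_omega1_def in_inv_image)
      then show "P y" by (rule less)
    qed
  qed
qed

lemma card_omega1: "|UNIV :: omega1 set| =o cardSuc natLeq"
proof -
  have "|UNIV :: omega1 set| =o |Field (cardSuc natLeq)|"
    by (rule card_of_ordIsoI[of Rep_omega1])
      (simp add: bij_betw_def inj_on_def Rep_omega1_inject type_definition.Rep_range[OF type_definition_omega1])
  then show ?thesis
    using card_of_Field_ordIso[OF Card_order_omega1] ordIso_transitive by blast
qed

lemma uncountable_omega1: "uncountable (UNIV :: omega1 set)"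
proof
  assume "countable (UNIV :: omega1 set)"
  then have "|UNIV :: omega1 set| \<le>o natLeq"
    by (simp add: countable_card_le_natLeq)
  then have "cardSuc natLeq \<le>o natLeq"
    using card_omega1 ordIso_ordLeq_trans ordIso_symmetric by blast
  then show False
    using cardSuc_greater[OF natLeq_Card_order] not_ordLess_ordLeq by blast
qed

lemma countable_less_omega1: "countable {..<a}" for a :: omega1
proof -
  have "|underS (cardSuc natLeq) (Rep_omega1 a)| \<le>o natLeq"
    using card_of_underS[OF Card_order_omega1 Rep_omega1]
      cardSuc_ordLeq_ordLess[OF natLeq_Card_order card_of_Card_order] by blast
  then have "countable (underS (cardSuc natLeq) (Rep_omega1 a))"
    by (simp add: countable_card_le_natLeq)
  moreover have "Rep_omega1 ` {..<a} \<subseteq> underS (cardSuc natLeq) (Rep_omega1 a)"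
    by (auto simp: underS_def less_omega1_def less_eq_omega1_def)
  ultimately have "countable (Rep_omega1 ` {..<a})"
    by (rule countable_subset[rotated])
  then show ?thesis
    by (rule countable_image_inj_on) (simp add: inj_on_def Rep_omega1_inject)
qed

lemma countable_atMost_omega1: "countable {..a}" for a :: omega1
proof -
  have "{..a} = insert a {..<a}" by auto
  then show ?thesis by (simp add: countable_less_omega1)
qed

lemma countable_imp_bounded_omega1:
  fixes S :: "omega1 set"
  assumes "countable S"
  obtains b where "\<And>a. a \<in> S \<Longrightarrow> a < b"
proof -
  have "countable (\<Union>a\<in>S. {..a})"
    using assms countable_atMost_omega1 by blast
  then have "(\<Union>a\<in>S. {..a}) \<noteq> UNIV"
    using uncountable_omega1 by metis
  then obtain b where "b \<notin> (\<Union>a\<in>S. {..a})" by blast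
  then show thesis by (intro that[of b]) auto
qed

text \<open>
  All transfinite constructions below choose the next object by looking only at the countable set
  of the previous ones, not at their order.
\<close>

lemma omega1_recursion:
  assumes "\<And>S. countable S \<Longrightarrow> S \<subseteq> A \<Longrightarrow> \<exists>x\<in>A. Q S x"
  obtains f :: "omega1 \<Rightarrow> 'b" where "\<And>a. f a \<in> A" "\<And>a. Q (f ` {..<a}) (f a)"
proof -
  have "\<exists>f :: omega1 \<Rightarrow> 'b. \<forall>a. f a \<in> A \<and> Q (f ` {..<a}) (f a)"
  proof (rule dependent_wellorder_choice)
    fix r :: 'b and f g :: "omega1 \<Rightarrow> 'b" and a
    assume "\<And>b. b < a \<Longrightarrow> f b = g b"
    then have "f ` {..<a} = g ` {..<a}" by (intro image_cong) auto
    then show "(r \<in> A \<and> Q (f ` {..<a}) r) = (r \<in> A \<and> Q (g ` {..<a}) r)" by simp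
  next
    fix a and f :: "omega1 \<Rightarrow> 'b"
    assume "\<And>b. b < a \<Longrightarrow> f b \<in> A \<and> Q (f ` {..<b}) (f b)"
    then have "f ` {..<a} \<subseteq> A" by auto
    then show "\<exists>r. r \<in> A \<and> Q (f ` {..<a}) r"
      using assms[of "f ` {..<a}"] countable_less_omega1[of a] by auto
  qed
  then show thesis using that by blast
qed

section \<open>Martin's Axiom for finite independent sets\<close>

text \<open>Independent sets of a directed graph.\<close>

definition indep :: "('i \<Rightarrow> 'i \<Rightarrow> bool) \<Rightarrow> 'i set \<Rightarrow> bool" where
  "indep E F \<longleftrightarrow> (\<forall>a\<in>F. \<forall>b\<in>F. \<not> E a b)"

lemma indep_subset: "indep E G \<Longrightarrow> F \<subseteq> G \<Longrightarrow> indep E F"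
  by (auto simp: indep_def)

text \<open>
  A filter in the order of finite independent sets has an independent union. Below a suitable
  condition \<open>q\<close> the sets of conditions reaching beyond a given \<open>a\<close> are dense, so that the union
  becomes uncountable. If there were no such \<open>q\<close>, each singleton \<open>{s}\<close> would extend to a condition
  \<open>g s\<close> all of whose extensions are bounded by some \<open>h s\<close>. Choosing each \<open>s\<close> above the bounds of
  the earlier ones makes the conditions \<open>g s\<close> an uncountable antichain.
\<close>

lemma MA_uncountable_indep:
  fixes E :: "omega1 \<Rightarrow> omega1 \<Rightarrow> bool"
  assumes MA: MA_omega1
    and irrefl: "\<And>a. \<not> E a a"
    and ccc: "\<And>\<A>. (\<And>F. F \<in> \<A> \<Longrightarrow> finite F \<and> indep E F) \<Longrightarrow>
      pairwise (\<lambda>F G. \<not> indep E (F \<union> G)) \<A> \<Longrightarrow> countable \<A>"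
  obtains H where "uncountable H" "indep E H"
proof -
  define Q where "Q = {F. finite F \<and> indep E F}"
  have single: "{a} \<in> Q" for a
    using irrefl by (simp add: Q_def indep_def)
  have "\<exists>q\<in>Q. \<forall>G\<in>Q. q \<subseteq> G \<longrightarrow> (\<forall>a. \<exists>F\<in>Q. G \<subseteq> F \<and> (\<exists>b\<in>F. a < b))"
  proof (rule ccontr)
    assume "\<not> ?thesis"
    then have "\<forall>q\<in>Q. \<exists>G\<in>Q. q \<subseteq> G \<and> (\<exists>a. \<forall>F\<in>Q. G \<subseteq> F \<longrightarrow> (\<forall>b\<in>F. b \<le> a))"
      by (simp add: not_less)
    from bspec[OF this single]
    have "\<exists>G. G \<in> Q \<and> {s} \<subseteq> G \<and> (\<exists>a. \<forall>F\<in>Q. G \<subseteq> F \<longrightarrow> (\<forall>b\<in>F. b \<le> a))" for s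
      unfolding Bex_def by assumption
    then obtain g where g: "\<And>s. g s \<in> Q" "\<And>s. {s} \<subseteq> g s"
      and "\<And>s. \<exists>a. \<forall>F\<in>Q. g s \<subseteq> F \<longrightarrow> (\<forall>b\<in>F. b \<le> a)"
      by metis
    then obtain h where h: "\<And>s F b. F \<in> Q \<Longrightarrow> g s \<subseteq> F \<Longrightarrow> b \<in> F \<Longrightarrow> b \<le> h s"
      by metis
    obtain f :: "omega1 \<Rightarrow> omega1" where f: "\<And>a. \<forall>s \<in> f ` {..<a}. h s < f a"
    proof (rule omega1_recursion[of UNIV "\<lambda>S x. \<forall>s\<in>S. h s < x"])
      fix S :: "omega1 set" assume "countable S"
      then have "countable (h ` S)" by simp
      then obtain b where "\<And>a. a \<in> h ` S \<Longrightarrow> a < b"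
        using countable_imp_bounded_omega1 by blast
      then show "\<exists>x\<in>UNIV. \<forall>s\<in>S. h s < x" by blast
    qed blast
    have notin: "f b \<notin> F" if "a < b" "F \<in> Q" "g (f a) \<subseteq> F" for a b F
      using f[of b] h[OF that(2,3), of "f b"] that(1) by force
    have inc: "\<not> indep E (g (f a) \<union> g (f b))" if "a < b" for a b
      using notin[OF that, of "g (f a) \<union> g (f b)"] g unfolding Q_def by blast
    have ne: "g (f a) \<noteq> g (f b)" if "a < b" for a b
      using notin[OF that g(1)] g(2) by blast
    have "countable (range (\<lambda>a. g (f a)))"
    proof (rule ccc)
      fix F assume "F \<in> range (\<lambda>a. g (f a))"
      then show "finite F \<and> indep E F" using g(1) by (auto simp: Q_def)
    next
      have "\<not> indep E (g (f a) \<union> g (f b))" if "g (f a) \<noteq> g (f b)" for a b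
        using inc[of a b] inc[of b a] that by (metis Un_commute neqE)
      then show "pairwise (\<lambda>F G. \<not> indep E (F \<union> G)) (range (\<lambda>a. g (f a)))"
        by (simp add: pairwise_def)
    qed
    moreover have "inj (\<lambda>a. g (f a))"
      using ne by (intro injI) (metis neqE)
    ultimately show False
      using countable_image_inj_on uncountable_omega1 by blast
  qed
  then obtain q where q: "q \<in> Q"
    and unb: "\<forall>G\<in>Q. q \<subseteq> G \<longrightarrow> (\<forall>a. \<exists>F\<in>Q. G \<subseteq> F \<and> (\<exists>b\<in>F. a < b))"
    by (rule bexE)
  define P where "P = {F \<in> Q. q \<subseteq> F}"
  define r where "r = {(F, G). F \<in> P \<and> G \<in> P \<and> G \<subseteq> F}"
  define D where "D a = {F \<in> P. \<exists>b\<in>F. a < b}" for a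
  have po: "partial_order_on P r"
    unfolding partial_order_on_def preorder_on_def
    by (auto simp: r_def refl_on_def trans_def antisym_def)
  have cccP: "ccc_order P r"
    unfolding ccc_order_def
  proof (intro allI impI)
    fix \<A> assume \<A>: "\<A> \<subseteq> P" "pairwise (\<lambda>F G. \<not> compatible_in P r F G) \<A>"
    show "countable \<A>"
    proof (rule ccc)
      show "finite F \<and> indep E F" if "F \<in> \<A>" for F
        using \<A>(1) that by (auto simp: P_def Q_def)
      have "compatible_in P r F G" if "F \<in> P" "G \<in> P" "indep E (F \<union> G)" for F G
        unfolding compatible_in_def using that
        by (intro bexI[of _ "F \<union> G"]) (auto simp: r_def P_def Q_def)
      then show "pairwise (\<lambda>F G. \<not> indep E (F \<union> G)) \<A>"
        using \<A> unfolding pairwise_def by blast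
    qed
  qed
  have dense: "dense_subset P r (D a)" for a
    unfolding dense_subset_def
  proof (intro conjI ballI)
    fix G assume "G \<in> P"
    then have "\<exists>F\<in>Q. G \<subseteq> F \<and> (\<exists>b\<in>F. a < b)"
      using unb by (simp add: P_def)
    then obtain F where "F \<in> Q" "G \<subseteq> F" "\<exists>b\<in>F. a < b"
      by blast
    then show "\<exists>F\<in>D a. (F, G) \<in> r"
      using \<open>G \<in> P\<close> by (intro bexI[of _ F]) (auto simp: r_def D_def P_def)
  qed (auto simp: D_def)
  have "|range D| \<le>o cardSuc natLeq"
    using ordLeq_ordIso_trans[OF card_of_image card_omega1] .
  moreover have "P \<noteq> {}" using q by (auto simp: P_def)
  moreover have "\<forall>D\<in>range D. dense_subset P r D" using dense by blast
  ultimately have "\<exists>\<G>. order_filter P r \<G> \<and> (\<forall>D\<in>range D. \<G> \<inter> D \<noteq> {})"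
    using po cccP
    by (intro MA_omega1_imp_MA_omega1_on[OF MA, unfolded MA_omega1_on_def,
          THEN spec, THEN spec, THEN spec, THEN mp] conjI)
  then obtain \<G> where filter: "order_filter P r \<G>" and "\<forall>D\<in>range D. \<G> \<inter> D \<noteq> {}"
    by (elim exE conjE)
  then have meets: "\<G> \<inter> D a \<noteq> {}" for a
    by simp
  show thesis
  proof (rule that)
    show "uncountable (\<Union>\<G>)"
    proof
      assume "countable (\<Union>\<G>)"
      then obtain a where a: "\<And>b. b \<in> \<Union>\<G> \<Longrightarrow> b < a"
        using countable_imp_bounded_omega1 by blast
      show False using meets[of a] a by (force simp: D_def)
    qed
    show "indep E (\<Union>\<G>)"
      unfolding indep_def
    proof (intro ballI)
      fix a b assume "a \<in> \<Union>\<G>" "b \<in> \<Union>\<G>"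
      then obtain F G where "F \<in> \<G>" "G \<in> \<G>" "a \<in> F" "b \<in> G" by blast
      moreover then obtain s where "s \<in> \<G>" "(s, F) \<in> r" "(s, G) \<in> r"
        using filter unfolding order_filter_def by blast
      ultimately have "s \<in> Q" "a \<in> s" "b \<in> s"
        by (auto simp: r_def P_def)
      then show "\<not> E a b" by (auto simp: Q_def indep_def)
    qed
  qed
qed

text \<open>
  This replaces the \<open>\<Delta>\<close>-system lemma. A point common to uncountably many members of an antichain
  can be removed from them: both members are independent, so the edge that makes their union
  dependent avoids every common point. As the size drops, this ends at an antichain in
  which no point occurs uncountably often.
\<close>

lemma uncountable_antichain_imp_thin:
  assumes "uncountable \<A>"
    and "\<And>F. F \<in> \<A> \<Longrightarrow> finite F \<and> card F = n \<and> indep E F"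
    and "pairwise (\<lambda>F G. \<not> indep E (F \<union> G)) \<A>"
  obtains \<B> m where "uncountable \<B>"
    "\<And>F. F \<in> \<B> \<Longrightarrow> finite F \<and> card F = m \<and> indep E F"
    "pairwise (\<lambda>F G. \<not> indep E (F \<union> G)) \<B>"
    "\<And>a. countable {F \<in> \<B>. a \<in> F}"
  using assms
proof (induction n arbitrary: \<A> thesis)
  case 0
  have "\<A> \<subseteq> {{}}" using 0(3) by fastforce
  then have "countable \<A>" by (rule countable_subset) simp
  then show ?case using 0(2) by simp
next
  case (Suc n)
  note \<A> = Suc.prems(2-4)
  show ?case
  proof (cases "\<forall>a. countable {F \<in> \<A>. a \<in> F}")
    case True
    then show ?thesis using \<A> by (intro Suc.prems(1)[of \<A> "Suc n"]) auto
  next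
    case False
    then obtain a where a: "uncountable {F \<in> \<A>. a \<in> F}" by blast
    let ?\<C> = "(\<lambda>F. F - {a}) ` {F \<in> \<A>. a \<in> F}"
    show ?thesis
    proof (rule Suc.IH[of thesis ?\<C>])
      show thesis if "uncountable \<B>"
        "\<And>F. F \<in> \<B> \<Longrightarrow> finite F \<and> card F = m \<and> indep E F"
        "pairwise (\<lambda>F G. \<not> indep E (F \<union> G)) \<B>"
        "\<And>a. countable {F \<in> \<B>. a \<in> F}" for \<B> m
        using that by (rule Suc.prems(1))
      have "inj_on (\<lambda>F. F - {a}) {F \<in> \<A>. a \<in> F}"
        by (auto simp: inj_on_def)
      then show "uncountable ?\<C>"
        using a countable_image_inj_on by blast
      show "finite F \<and> card F = n \<and> indep E F" if F: "F \<in> ?\<C>" for F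
      proof -
        obtain G where "G \<in> \<A>" "a \<in> G" "F = G - {a}" using F by blast
        then show ?thesis using \<A>(2)[of G] indep_subset[of E G F] by auto
      qed
      have "\<not> indep E (F - {a} \<union> (G - {a}))" if FG: "F \<in> \<A>" "G \<in> \<A>" "a \<in> F" "a \<in> G" "F \<noteq> G" for F G
      proof -
        have "\<not> indep E (F \<union> G)" using \<A>(3) FG by (auto simp: pairwise_def)
        then obtain c d where "c \<in> F \<union> G" "d \<in> F \<union> G" "E c d" by (auto simp: indep_def)
        moreover have "indep E F" "indep E G" using \<A>(2) FG by auto
        ultimately show ?thesis using FG unfolding indep_def
          by (metis Diff_iff Un_iff singletonD)
      qed
      then show "pairwise (\<lambda>F G. \<not> indep E (F \<union> G)) ?\<C>"
        unfolding pairwise_def by auto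
    qed
  qed
qed

text \<open>
  Only countably many members of a thinned antichain meet a given initial segment of \<open>\<omega>\<^sub>1\<close>, so
  members can be picked one beyond the other. Since edges go upwards, an edge inside the
  union of two blocks must lead from the earlier one to the later one.
\<close>

lemma uncountable_antichain_imp_blocks:
  fixes E :: "omega1 \<Rightarrow> omega1 \<Rightarrow> bool"
  assumes E: "\<And>a b. E a b \<Longrightarrow> a < b"
    and unc: "uncountable \<A>"
    and \<A>: "\<And>F. F \<in> \<A> \<Longrightarrow> finite F \<and> indep E F"
    and anti: "pairwise (\<lambda>F G. \<not> indep E (F \<union> G)) \<A>"
  obtains F :: "omega1 \<Rightarrow> omega1 set" and n where
    "\<And>a. finite (F a)" "\<And>a. card (F a) = n"
    "\<And>a b i j. a < b \<Longrightarrow> i \<in> F a \<Longrightarrow> j \<in> F b \<Longrightarrow> i < j"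
    "\<And>a b. a < b \<Longrightarrow> \<exists>i\<in>F a. \<exists>j\<in>F b. E i j"
proof -
  have "\<exists>n. uncountable {F \<in> \<A>. card F = n}"
  proof (rule ccontr)
    assume "\<not> ?thesis"
    then have "countable (\<Union>n. {F \<in> \<A>. card F = n})" by blast
    moreover have "(\<Union>n. {F \<in> \<A>. card F = n}) = \<A>" by blast
    ultimately show False using unc by simp
  qed
  then obtain n where "uncountable {F \<in> \<A>. card F = n}" by blast
  then obtain \<B> m where \<B>: "uncountable \<B>"
    "\<And>F. F \<in> \<B> \<Longrightarrow> finite F \<and> card F = m \<and> indep E F"
    "pairwise (\<lambda>F G. \<not> indep E (F \<union> G)) \<B>"
    "\<And>a. countable {F \<in> \<B>. a \<in> F}"
  proof (rule uncountable_antichain_imp_thin)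
    show "finite F \<and> card F = n \<and> indep E F" if "F \<in> {F \<in> \<A>. card F = n}" for F
      using \<A> that by simp
    show "pairwise (\<lambda>F G. \<not> indep E (F \<union> G)) {F \<in> \<A>. card F = n}"
      using anti by (simp add: pairwise_def)
  qed blast
  obtain F :: "omega1 \<Rightarrow> omega1 set" where F: "\<And>a. F a \<in> \<B>"
    and less: "\<And>a. \<forall>G \<in> F ` {..<a}. F a \<noteq> G \<and> (\<forall>i\<in>G. \<forall>j\<in>F a. i < j)"
  proof (rule omega1_recursion[of \<B> "\<lambda>S G'. \<forall>G\<in>S. G' \<noteq> G \<and> (\<forall>i\<in>G. \<forall>j\<in>G'. i < j)"])
    fix S assume S: "countable S" "S \<subseteq> \<B>"
    have "countable (\<Union>G\<in>S. G)"
      using S \<B>(2) by (intro countable_UN) (auto intro: countable_finite)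
    then obtain b where b: "\<And>a. a \<in> (\<Union>G\<in>S. G) \<Longrightarrow> a < b"
      using countable_imp_bounded_omega1 by blast
    have "countable (S \<union> (\<Union>a\<in>{..b}. {F \<in> \<B>. a \<in> F}))"
      using S(1) \<B>(4) countable_atMost_omega1 by blast
    then have "\<not> \<B> \<subseteq> S \<union> (\<Union>a\<in>{..b}. {F \<in> \<B>. a \<in> F})"
      using \<B>(1) countable_subset by blast
    then obtain G' where G': "G' \<in> \<B>" "G' \<notin> S" "\<And>a. a \<le> b \<Longrightarrow> a \<notin> G'"
      by auto
    then have "i < j" if "i \<in> G" "G \<in> S" "j \<in> G'" for i j G
      using b[of i] that G'(3)[of j] by (meson UN_I less_trans not_le)
    then show "\<exists>G'\<in>\<B>. \<forall>G\<in>S. G' \<noteq> G \<and> (\<forall>i\<in>G. \<forall>j\<in>G'. i < j)"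
      using G'(1,2) by blast
  qed blast
  show thesis
  proof (rule that[of F m])
    show "finite (F a)" "card (F a) = m" for a using \<B>(2) F by auto
    show lt: "i < j" if "a < b" "i \<in> F a" "j \<in> F b" for a b i j
      using less[of b] that by auto
    show "\<exists>i\<in>F a. \<exists>j\<in>F b. E i j" if ab: "a < b" for a b
    proof -
      have "F b \<noteq> F a" using less[of b] ab by auto
      then have "\<not> indep E (F a \<union> F b)"
        using \<B>(3) F unfolding pairwise_def by metis
      then obtain i j where "i \<in> F a \<union> F b" "j \<in> F a \<union> F b" "E i j" by (auto simp: indep_def)
      moreover have "indep E (F a)" "indep E (F b)" using \<B>(2) F by auto
      ultimately show ?thesis using lt[OF ab] E unfolding indep_def
        by (metis Un_iff less_asym)
    qed
  qed
qed

section \<open>Countable tightness\<close>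

text \<open>
  A space is countably tight if each closure \<open>cl A\<close> is the union of the \<open>cl S\<close> for countable
  \<open>S \<subseteq> A\<close>. This holds exactly when sets that contain the closures of their countable subsets are
  closed, and the latter form is the convenient one here.
\<close>

definition omega_closedin :: "'a topology \<Rightarrow> 'a set \<Rightarrow> bool" where
  "omega_closedin T G \<longleftrightarrow> G \<subseteq> topspace T \<and> (\<forall>S\<subseteq>G. countable S \<longrightarrow> T closure_of S \<subseteq> G)"

definition countably_tight :: "'a topology \<Rightarrow> bool" where
  "countably_tight T \<longleftrightarrow> (\<forall>G. omega_closedin T G \<longrightarrow> closedin T G)"

lemma omega_closedin_Int_closedin:
  "omega_closedin T G \<Longrightarrow> closedin T C \<Longrightarrow> omega_closedin T (G \<inter> C)"
  unfolding omega_closedin_def by (meson closure_of_minimal inf.boundedE inf.coboundedI1 le_inf_iff)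

lemma omega_closedin_image:
  assumes "compact_space Z" "Hausdorff_space A" "continuous_map Z A f" "omega_closedin Z G"
  shows "omega_closedin A (f ` G)"
  unfolding omega_closedin_def
proof (intro conjI allI impI)
  show "f ` G \<subseteq> topspace A"
    using assms(3,4) by (auto simp: omega_closedin_def dest: continuous_map_funspace)
  fix S assume "S \<subseteq> f ` G" "countable S"
  then obtain R where R: "R \<subseteq> G" "countable R" "S = f ` R"
    by (metis countable_subset_image)
  have "closed_map Z A f"
    using assms by (intro continuous_imp_closed_map)
  then have "closedin A (f ` (Z closure_of R))"
    by (simp add: closed_map_def)
  moreover have "S \<subseteq> f ` (Z closure_of R)"
    using R assms(4) by (auto simp: omega_closedin_def intro!: imageI closure_of_subset[THEN subsetD])
  ultimately have "A closure_of S \<subseteq> f ` (Z closure_of R)"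
    by (rule closure_of_minimal[rotated])
  moreover have "Z closure_of R \<subseteq> G"
    using R assms(4) by (simp add: omega_closedin_def)
  ultimately show "A closure_of S \<subseteq> f ` G"
    by (meson image_mono subset_trans)
qed

lemma regular_space_closed_neighbourhood:
  assumes "regular_space X" "openin X U" "x \<in> U"
  obtains W K where "openin X W" "closedin X K" "x \<in> W" "W \<subseteq> K" "K \<subseteq> U"
proof -
  have "neighbourhood_base_of (closedin X) X"
    using assms(1) by (simp add: neighbourhood_base_of_closedin)
  then show thesis
    using assms(2,3) that unfolding neighbourhood_base_of by blast
qed

text \<open>
  The core of Malykhin's theorem on products, stated for a compact space that embeds into \<open>A \<times> B\<close>
  by \<open>(f, g)\<close>. Suppose that \<open>z\<close> is in the closure of \<open>G\<close> but not in \<open>G\<close>. Tightness of \<open>B\<close> makes the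
  \<open>g\<close>-image of the fibre of \<open>G\<close> over \<open>f z\<close> closed, and it misses \<open>g z\<close>. So it also misses a closed
  neighbourhood \<open>K\<close> of \<open>g z\<close>. By tightness of \<open>A\<close>, the \<open>f\<close>-image of the part of \<open>G\<close> lying over \<open>K\<close> is
  closed, hence contains \<open>f z\<close>, which puts a point of that fibre over \<open>K\<close>.
\<close>

lemma countably_tight_jointly_injective:
  assumes Z: "compact_space Z"
    and A: "Hausdorff_space A" "countably_tight A" "continuous_map Z A f"
    and B: "Hausdorff_space B" "regular_space B" "countably_tight B" "continuous_map Z B g"
    and inj: "\<And>z w. z \<in> topspace Z \<Longrightarrow> w \<in> topspace Z \<Longrightarrow> f z = f w \<Longrightarrow> g z = g w \<Longrightarrow> z = w"
  shows "countably_tight Z"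
  unfolding countably_tight_def
proof (intro allI impI)
  fix G assume G: "omega_closedin Z G"
  then have GZ: "G \<subseteq> topspace Z" by (simp add: omega_closedin_def)
  have "z \<in> G" if z: "z \<in> Z closure_of G" for z
  proof (rule ccontr)
    assume zG: "z \<notin> G"
    have zZ: "z \<in> topspace Z"
      using z by (simp add: in_closure_of)
    have fz: "f z \<in> topspace A" and gz: "g z \<in> topspace B"
      using zZ A(3) B(4) by (auto dest: continuous_map_funspace)
    define F where "F = {w \<in> topspace Z. f w \<in> {f z}}"
    have "closedin A {f z}"
      using A(1) fz by (simp add: closedin_Hausdorff_singleton)
    then have "closedin Z F"
      using A(3) unfolding F_def by (rule closedin_continuous_map_preimage[rotated])
    then have "closedin B (g ` (G \<inter> F))"
      using B(3) omega_closedin_image[OF Z B(1,4) omega_closedin_Int_closedin[OF G]]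
      by (simp add: countably_tight_def)
    then have "openin B (topspace B - g ` (G \<inter> F))" by blast
    moreover have "g z \<notin> g ` (G \<inter> F)"
    proof
      assume "g z \<in> g ` (G \<inter> F)"
      then obtain w where "w \<in> G" "w \<in> F" "g z = g w" by blast
      then show False using inj[OF zZ, of w] zG by (simp add: F_def)
    qed
    ultimately obtain V K where V: "openin B V" "closedin B K" "g z \<in> V" "V \<subseteq> K"
      "K \<subseteq> topspace B - g ` (G \<inter> F)"
      using regular_space_closed_neighbourhood[OF B(2)] gz by (metis DiffI)
    define L where "L = {w \<in> topspace Z. g w \<in> K}"
    define W where "W = {w \<in> topspace Z. g w \<in> V}"
    have "closedin Z L"
      using B(4) V(2) unfolding L_def by (rule closedin_continuous_map_preimage)
    then have "closedin A (f ` (G \<inter> L))"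
      using A(2) omega_closedin_image[OF Z A(1,3) omega_closedin_Int_closedin[OF G]]
      by (simp add: countably_tight_def)
    then have "closedin Z {w \<in> topspace Z. f w \<in> f ` (G \<inter> L)}"
      using A(3) by (rule closedin_continuous_map_preimage[rotated])
    moreover have "G \<inter> L \<subseteq> {w \<in> topspace Z. f w \<in> f ` (G \<inter> L)}"
      using GZ by blast
    ultimately have "Z closure_of (G \<inter> L) \<subseteq> {w \<in> topspace Z. f w \<in> f ` (G \<inter> L)}"
      by (rule closure_of_minimal[rotated])
    moreover have "openin Z W"
      using B(4) V(1) unfolding W_def by (rule openin_continuous_map_preimage)
    then have "W \<inter> Z closure_of G \<subseteq> Z closure_of (W \<inter> G)"
      by (rule openin_Int_closure_of_subset)
    then have "z \<in> Z closure_of (G \<inter> W)"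
      using z zZ V(3) by (auto simp: W_def Int_commute)
    then have "z \<in> Z closure_of (G \<inter> L)"
      using V(4) closure_of_mono[of "G \<inter> W" "G \<inter> L" Z] by (auto simp: W_def L_def)
    ultimately obtain w where w: "w \<in> G" "w \<in> L" "f z = f w" by blast
    then have "g w \<in> g ` (G \<inter> F)" using GZ by (auto simp: F_def)
    then show False using w V(5) by (auto simp: L_def)
  qed
  then show "closedin Z G"
    using GZ by (metis closure_of_subset closure_of_subset_eq subsetI)
qed

lemma countably_tight_product_topology:
  assumes X: "compact_space X" "Hausdorff_space X" "countably_tight X" and "finite I"
  shows "countably_tight (product_topology (\<lambda>_. X) I)"
  using \<open>finite I\<close>
proof (induction I)
  case empty
  show ?case
    unfolding countably_tight_def omega_closedin_def
    by (auto simp: closedin_def openin_product_topology_empty)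
next
  case (insert i I)
  let ?T = "\<lambda>I. product_topology (\<lambda>_. X) I"
  have comp: "compact_space (?T J)" and haus: "Hausdorff_space (?T J)" for J
    using X by (auto simp: compact_space_product_topology Hausdorff_space_product_topology)
  show ?case
  proof (rule countably_tight_jointly_injective[where f="\<lambda>x. x i" and g="\<lambda>x. restrict x I"])
    have proj: "continuous_map (?T (insert i I)) X (\<lambda>x. x j)" if "j \<in> insert i I" for j
      using continuous_map_product_coordinates[OF that, of "\<lambda>_. X"] .
    then show "continuous_map (?T (insert i I)) (?T I) (\<lambda>x. restrict x I)"
      by (auto simp: continuous_map_componentwise)
    show "continuous_map (?T (insert i I)) X (\<lambda>x. x i)"
      by (rule proj) simp
    show "regular_space (?T I)"
      using comp haus by (rule compact_Hausdorff_imp_regular_space)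
    show "x = y" if "x \<in> topspace (?T (insert i I))" "y \<in> topspace (?T (insert i I))"
      "x i = y i" "restrict x I = restrict y I" for x y
    proof (rule PiE_ext)
      show "x \<in> insert i I \<rightarrow>\<^sub>E topspace X" "y \<in> insert i I \<rightarrow>\<^sub>E topspace X"
        using that by auto
      show "x j = y j" if "j \<in> insert i I" for j
        using that \<open>x i = y i\<close> fun_cong[OF \<open>restrict x I = restrict y I\<close>, of j] by auto
    qed
  qed (use X comp haus insert.IH in auto)
qed

text \<open>
  Isolating neighbourhoods also force the family to be injective, so that its index set, not
  just its range, is countable.
\<close>

lemma countable_spread_discrete_family:
  assumes spread: "countable_spread X"
    and y: "\<And>a. a \<in> H \<Longrightarrow> y a \<in> topspace X"
    and iso: "\<And>a. a \<in> H \<Longrightarrow> \<exists>U. openin X U \<and> y a \<in> U \<and> (\<forall>b\<in>H. y b \<in> U \<longrightarrow> b = a)"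
  shows "countable H"
proof -
  have "y a \<notin> X derived_set_of (y ` H)" if a: "a \<in> H" for a
  proof -
    obtain U where "openin X U" "y a \<in> U" "\<And>b. b \<in> H \<Longrightarrow> y b \<in> U \<Longrightarrow> b = a"
      using iso[OF a] by blast
    then show ?thesis
      unfolding in_derived_set_of by blast
  qed
  then have "y ` H \<inter> X derived_set_of (y ` H) = {}"
    by blast
  then have "subtopology X (y ` H) = discrete_topology (y ` H)"
    using y by (intro subtopology_eq_discrete_topology) auto
  then have "countable (y ` H)"
    using spread y unfolding countable_spread_def by (metis image_subsetI)
  moreover have "inj_on y H"
    using iso by (metis inj_onI)
  ultimately show ?thesis
    by (rule countable_image_inj_on)
qed

lemma compact_space_omega1_nest:
  fixes C :: "omega1 \<Rightarrow> 'a set"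
  assumes X: "compact_space X" and C: "\<And>a. closedin X (C a)" "\<And>a. C a \<noteq> {}"
    and dec: "\<And>a b. a \<le> b \<Longrightarrow> C b \<subseteq> C a"
  shows "(\<Inter>a. C a) \<noteq> {}"
proof -
  have "\<Inter>\<F> \<noteq> {}" if \<F>: "finite \<F>" "\<F> \<subseteq> range C" for \<F>
  proof (cases "\<F> = {}")
    case False
    obtain A where A: "finite A" "\<F> = C ` A"
      using \<F> by (meson finite_subset_image)
    then have "A \<noteq> {}" using False by auto
    then have "C (Max A) \<subseteq> \<Inter>\<F>"
      using A dec[OF Max_ge] by blast
    then show ?thesis using C(2)[of "Max A"] by blast
  qed simp
  then show ?thesis
    using X[unfolded compact_space_fip, rule_format, of "range C"] C(1) by auto
qed

text \<open>
  Closed disjoint sets \<open>C b\<close> and \<open>D b\<close> separating the initial segments from the final ones make \<open>y\<close>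
  a free sequence. By compactness some \<open>x\<close> lies in the closure of every final segment. By
  tightness the union of the closures of the initial segments is closed, so \<open>x\<close> lies in the closure of
  an initial segment too.
\<close>

lemma countably_tight_no_free_sequence:
  fixes y :: "omega1 \<Rightarrow> 'a"
  assumes X: "compact_space X" "countably_tight X" and y: "\<And>a. y a \<in> topspace X"
    and C: "\<And>b. closedin X (C b)" and D: "\<And>b. closedin X (D b)"
    and initial: "\<And>a b. a < b \<Longrightarrow> y a \<in> C b" and final: "\<And>a b. b < a \<Longrightarrow> y a \<in> D b"
    and disj: "\<And>b. C b \<inter> D b = {}"
  shows False
proof -
  define G where "G = (\<Union>b. X closure_of (y ` {..<b}))"
  have "omega_closedin X G"
    unfolding omega_closedin_def
  proof (intro conjI allI impI)
    show "G \<subseteq> topspace X"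
      using closure_of_subset_topspace[of X] by (auto simp: G_def)
    fix S assume S: "S \<subseteq> G" "countable S"
    then have "\<forall>x\<in>S. \<exists>b. x \<in> X closure_of (y ` {..<b})"
      by (auto simp: G_def)
    then obtain h where h: "\<And>x. x \<in> S \<Longrightarrow> x \<in> X closure_of (y ` {..<h x})"
      by metis
    have "countable (h ` S)" using S(2) by simp
    then obtain b where b: "\<And>a. a \<in> h ` S \<Longrightarrow> a < b"
      using countable_imp_bounded_omega1 by blast
    have "S \<subseteq> X closure_of (y ` {..<b})"
    proof
      fix x assume x: "x \<in> S"
      then have "y ` {..<h x} \<subseteq> y ` {..<b}"
        using b[of "h x"] by auto
      then show "x \<in> X closure_of (y ` {..<b})"
        using h[OF x] closure_of_mono by blast
    qed
    then have "X closure_of S \<subseteq> X closure_of (y ` {..<b})"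
      by (rule closure_of_minimal) simp
    then show "X closure_of S \<subseteq> G"
      by (auto simp: G_def)
  qed
  then have closed: "closedin X G"
    using X(2) by (simp add: countably_tight_def)
  have yG: "y a \<in> G" for a
  proof -
    obtain b where "a < b" using countable_imp_bounded_omega1[of "{a}"] by auto
    then have "y a \<in> X closure_of (y ` {..<b})"
      using y by (intro closure_of_subset[THEN subsetD]) auto
    then show ?thesis by (auto simp: G_def)
  qed
  have "(\<Inter>b. X closure_of (y ` {b..})) \<noteq> {}"
  proof (rule compact_space_omega1_nest[OF X(1)])
    show "X closure_of (y ` {b..}) \<noteq> {}" for b
      using y by (subst closure_of_eq_empty) auto
    show "X closure_of (y ` {b..}) \<subseteq> X closure_of (y ` {a..})" if "a \<le> b" for a b
      using that by (intro closure_of_mono image_mono) auto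
  qed simp
  then obtain x where x: "\<And>b. x \<in> X closure_of (y ` {b..})" by blast
  have "X closure_of (y ` {undefined..}) \<subseteq> G"
    using yG closed by (intro closure_of_minimal) auto
  then obtain b where b: "x \<in> X closure_of (y ` {..<b})"
    using x[of undefined] by (auto simp: G_def)
  obtain c where c: "b < c" using countable_imp_bounded_omega1[of "{b}"] by auto
  have "X closure_of (y ` {..<b}) \<subseteq> C b"
    using initial C by (intro closure_of_minimal) auto
  moreover have "X closure_of (y ` {c..}) \<subseteq> D b"
    using final D c by (intro closure_of_minimal) auto
  ultimately show False using b x[of c] disj[of b] by blast
qed

text \<open>
  If \<open>G\<close> contains the closures of its countable subsets, and \<open>p\<close> is in its closure but not in \<open>G\<close>,
  then \<open>G\<close> meets every intersection of countably many closed neighbourhoods of \<open>p\<close>. A recursion thus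
  chooses points \<open>y\<^sub>a \<in> G\<close> and closed neighbourhoods \<open>C\<^sub>a\<close> of \<open>p\<close> with \<open>C\<^sub>a\<close> disjoint from the closure
  of the earlier points and \<open>y\<^sub>a\<close> in all \<open>C\<^sub>b\<close> with \<open>b \<le> a\<close>. The points \<open>y\<^sub>a\<close> form a discrete subspace.
\<close>

lemma countable_spread_imp_countably_tight:
  assumes X: "compact_space X" "Hausdorff_space X" "countable_spread X"
  shows "countably_tight X"
  unfolding countably_tight_def
proof (intro allI impI)
  fix G assume G: "omega_closedin X G"
  then have GX: "G \<subseteq> topspace X"
    and GS: "\<And>S. S \<subseteq> G \<Longrightarrow> countable S \<Longrightarrow> X closure_of S \<subseteq> G"
    by (auto simp: omega_closedin_def)
  have reg: "regular_space X"
    using X by (intro compact_Hausdorff_imp_regular_space)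
  have "p \<in> G" if p: "p \<in> X closure_of G" for p
  proof (rule ccontr)
    assume pG: "p \<notin> G"
    define nbhds where "nbhds = {C. closedin X C \<and> p \<in> X interior_of C}"
    have meet: "\<exists>x\<in>G. x \<in> \<Inter>\<C>" if \<C>: "countable \<C>" "\<C> \<subseteq> nbhds" for \<C>
    proof (cases "\<C> = {}")
      case True
      then show ?thesis using p by (auto simp: in_closure_of)
    next
      case False
      obtain N :: "nat \<Rightarrow> 'a set" where N: "range N = \<C>"
        by (rule that[OF range_from_nat_into[OF False \<C>(1)]])
      have N1: "closedin X (N i)" "p \<in> X interior_of (N i)" for i
        using \<C>(2) N by (auto simp: nbhds_def)
      have "\<exists>x\<in>G. \<forall>i\<le>n. x \<in> N i" for n :: nat
      proof -
        define T where "T = (\<Inter>i\<in>{..n}. X interior_of (N i))"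
        have "openin X T" unfolding T_def by (intro openin_INT2) auto
        moreover have "p \<in> T" using N1(2) by (simp add: T_def)
        ultimately obtain x where "x \<in> G" "x \<in> T"
          using p unfolding in_closure_of by blast
        moreover then have "x \<in> N i" if "i \<le> n" for i
          using that interior_of_subset[of X "N i"] by (auto simp: T_def)
        ultimately show ?thesis by blast
      qed
      then obtain g where g: "\<And>n. g n \<in> G" "\<And>n i. i \<le> n \<Longrightarrow> g n \<in> N i"
        by metis
      have "(\<Inter>n. X closure_of (g ` {n..})) \<noteq> {}"
      proof (rule compact_space_imp_nest[OF X(1)])
        show "X closure_of (g ` {n..}) \<noteq> {}" for n
          using g GX by (subst closure_of_eq_empty) auto
        show "decseq (\<lambda>n. X closure_of (g ` {n..}))"
          unfolding decseq_def by (intro allI impI closure_of_mono image_mono) auto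
      qed simp
      then obtain x where x: "\<And>n. x \<in> X closure_of (g ` {n..})" by blast
      have "X closure_of (g ` {0..}) \<subseteq> G"
        using g by (intro GS) auto
      then have "x \<in> G" using x by blast
      moreover have "X closure_of (g ` {i..}) \<subseteq> N i" for i
        using g N1 by (intro closure_of_minimal) auto
      then have "x \<in> N i" for i using x by blast
      ultimately show ?thesis using N by blast
    qed
    \<comment> \<open>The recursion runs on pairs of a point and a neighbourhood, as each neighbourhood depends on
      all earlier points.\<close>
    have "\<exists>z. z \<in> G \<times> nbhds \<and>
        snd z \<inter> X closure_of (fst ` S) = {} \<and> fst z \<in> snd z \<and> (\<forall>s\<in>S. fst z \<in> snd s)"
      if S: "countable S" "S \<subseteq> G \<times> nbhds" for S
    proof -
      have "X closure_of (fst ` S) \<subseteq> G"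
        using S by (intro GS) auto
      then have "p \<in> topspace X - X closure_of (fst ` S)"
        using p pG closure_of_subset_topspace[of X G] by blast
      moreover have "openin X (topspace X - X closure_of (fst ` S))"
        by (intro openin_diff) auto
      ultimately obtain W K where W: "openin X W" "closedin X K" "p \<in> W" "W \<subseteq> K"
        "K \<subseteq> topspace X - X closure_of (fst ` S)"
        by (metis regular_space_closed_neighbourhood[OF reg])
      then have K: "K \<in> nbhds"
        using interior_of_maximal[of W K X] by (auto simp: nbhds_def)
      have "countable (insert K (snd ` S))" "insert K (snd ` S) \<subseteq> nbhds"
        using S K by auto
      then obtain x where "x \<in> G" "x \<in> \<Inter>(insert K (snd ` S))"
        using meet by blast
      then show ?thesis using K W(5) by (intro exI[of _ "(x, K)"]) auto
    qed
    then have step: "\<exists>z\<in>G \<times> nbhds.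
        snd z \<inter> X closure_of (fst ` S) = {} \<and> fst z \<in> snd z \<and> (\<forall>s\<in>S. fst z \<in> snd s)"
      if "countable S" "S \<subseteq> G \<times> nbhds" for S
      using that unfolding Bex_def by blast
    obtain f :: "omega1 \<Rightarrow> 'a \<times> 'a set" where f: "\<And>a. f a \<in> G \<times> nbhds"
      and f': "\<And>a. snd (f a) \<inter> X closure_of (fst ` f ` {..<a}) = {} \<and> fst (f a) \<in> snd (f a) \<and>
        (\<forall>s\<in>f ` {..<a}. fst (f a) \<in> snd s)"
      by (rule omega1_recursion[of "G \<times> nbhds" "\<lambda>S z. snd z \<inter> X closure_of (fst ` S) = {} \<and>
          fst z \<in> snd z \<and> (\<forall>s\<in>S. fst z \<in> snd s)"]) (rule step, assumption+, blast)
    define y C where "y a = fst (f a)" and "C a = snd (f a)" for a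
    have y: "y a \<in> G" and clo: "closedin X (C a)" for a
      using f[of a] by (auto simp: y_def C_def nbhds_def mem_Times_iff)
    have disj: "C a \<inter> X closure_of (y ` {..<a}) = {}" for a
      using f'[of a] by (simp add: y_def C_def image_image)
    have yC: "y a \<in> C b" if "b \<le> a" for a b
      using f'[of a] that by (cases "b = a") (auto simp: y_def C_def)
    have "countable (UNIV :: omega1 set)"
    proof (rule countable_spread_discrete_family[OF X(3)])
      show "y a \<in> topspace X" for a using y GX by blast
      fix a :: omega1
      obtain b0 where b0: "a < b0" using countable_imp_bounded_omega1[of "{a}"] by auto
      have "\<exists>b>a. \<forall>c>a. b \<le> c"
        using b0 by (intro exI[of _ "LEAST b. a < b"]) (auto intro: LeastI Least_le)
      then obtain b where b: "a < b" "\<And>c. a < c \<Longrightarrow> b \<le> c" by blast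
      \<comment> \<open>The first set removed contains the points before \<open>y a\<close>, and \<open>C b\<close> those from the
        successor \<open>b\<close> of \<open>a\<close> on.\<close>
      let ?U = "(topspace X - X closure_of (y ` {..<a})) - C b"
      show "\<exists>U. openin X U \<and> y a \<in> U \<and> (\<forall>c\<in>UNIV. y c \<in> U \<longrightarrow> c = a)"
      proof (intro exI[of _ ?U] conjI ballI impI)
        show "openin X ?U" using clo by (intro openin_diff) auto
        have "y a \<in> X closure_of (y ` {..<b})"
          using b y GX by (intro closure_of_subset[THEN subsetD]) auto
        then show "y a \<in> ?U"
          using disj[of a] disj[of b] yC[of a a] y[of a] GX by auto
        fix c assume c: "y c \<in> ?U"
        show "c = a"
        proof (cases rule: linorder_cases[of c a])
          case less
          then have "y c \<in> X closure_of (y ` {..<a})"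
            using y GX by (intro closure_of_subset[THEN subsetD]) auto
          then show ?thesis using c by blast
        next
          case greater
          then show ?thesis using c yC[OF b(2)] by blast
        qed
      qed
    qed
    then show False using uncountable_omega1 by blast
  qed
  then show "closedin X G"
    using GX by (metis closure_of_subset closure_of_subset_eq subsetI)
qed

text \<open>
  The previous results in the finite power \<open>X\<^sup>I\<close>: the tuples with some coordinate in \<open>C b\<close> and
  those with all coordinates in \<open>D b\<close> are disjoint closed sets.
\<close>

lemma countably_tight_no_free_tuples:
  fixes z :: "omega1 \<Rightarrow> 'i \<Rightarrow> 'a"
  assumes X: "compact_space X" "Hausdorff_space X" "countably_tight X" and I: "finite I"
    and z: "\<And>a i. i \<in> I \<Longrightarrow> z a i \<in> topspace X"
    and C: "\<And>b. closedin X (C b)" and D: "\<And>b. closedin X (D b)"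
    and initial: "\<And>a b. a < b \<Longrightarrow> \<exists>i\<in>I. z a i \<in> C b"
    and final: "\<And>a b i. b < a \<Longrightarrow> i \<in> I \<Longrightarrow> z a i \<in> D b"
    and disj: "\<And>b. C b \<inter> D b = {}"
  shows False
proof -
  let ?T = "product_topology (\<lambda>_. X) I"
  have proj: "continuous_map ?T X (\<lambda>x. x i)" if "i \<in> I" for i
    using continuous_map_product_coordinates[OF that, of "\<lambda>_. X"] .
  show False
  proof (rule countably_tight_no_free_sequence)
    show "compact_space ?T"
      using X by (simp add: compact_space_product_topology)
    show "countably_tight ?T"
      using X I by (rule countably_tight_product_topology)
    show top: "restrict (z a) I \<in> topspace ?T" for a
      using z by auto
    show "closedin ?T (\<Union>i\<in>I. {x \<in> topspace ?T. x i \<in> C b})" for b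
      using I closedin_continuous_map_preimage[OF proj C] by (intro closedin_Union) auto
    have "openin ?T {x \<in> topspace ?T. x i \<in> topspace X - D b}" if "i \<in> I" for i b
      using D by (intro openin_continuous_map_preimage[OF proj[OF that]]) auto
    then show "closedin ?T (topspace ?T - (\<Union>i\<in>I. {x \<in> topspace ?T. x i \<in> topspace X - D b}))" for b
      by (intro closedin_diff closedin_topspace openin_Union) auto
    show "restrict (z a) I \<in> (\<Union>i\<in>I. {x \<in> topspace ?T. x i \<in> C b})" if "a < b" for a b
      using initial[OF that] top[of a] by (metis (mono_tags, lifting) UN_I mem_Collect_eq restrict_apply')
    show "restrict (z a) I \<in> topspace ?T - (\<Union>i\<in>I. {x \<in> topspace ?T. x i \<in> topspace X - D b})"
      if "b < a" for a b
      using final[OF that] top[of a] by auto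
    have "x i \<in> topspace X - D b" if "x i \<in> C b" for x :: "'i \<Rightarrow> 'a" and i b
      using that disj[of b] closedin_subset[OF C[of b]] by blast
    then show "(\<Union>i\<in>I. {x \<in> topspace ?T. x i \<in> C b}) \<inter>
        (topspace ?T - (\<Union>i\<in>I. {x \<in> topspace ?T. x i \<in> topspace X - D b})) = {}" for b
      by blast
  qed
qed

section \<open>\<open>G\<^sub>\<delta>\<close> points and local \<open>\<pi>\<close>-bases\<close>

text \<open>
  The neighbourhoods \<open>N x\<close> of \<open>p\<close> and \<open>U x\<close> of \<open>x\<close> are disjoint, and \<open>y b\<close> is chosen in \<open>N (y a)\<close> for
  all \<open>a < b\<close>, which is possible as \<open>p\<close> is not a \<open>G\<^sub>\<delta>\<close>. So \<open>U (y a)\<close> contains no later point. The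
  order is built from the smaller sets \<open>W\<close>, since the free sequence needs a closed set between
  the neighbourhood that catches \<open>y a\<close> and the one that excludes later points.
\<close>

lemma MA_countable_spread_imp_gdelta_point:
  assumes MA: MA_omega1 and X: "compact_space X" "Hausdorff_space X" "countable_spread X"
    and p: "p \<in> topspace X"
  shows "gdelta_in X {p}"
proof (rule ccontr)
  assume no: "\<not> gdelta_in X {p}"
  have reg: "regular_space X"
    using X by (intro compact_Hausdorff_imp_regular_space)
  have other: "\<exists>x\<in>topspace X - {p}. \<forall>N\<in>\<N>. x \<in> N"
    if \<N>: "countable \<N>" "\<And>N. N \<in> \<N> \<Longrightarrow> openin X N \<and> p \<in> N" for \<N>
  proof (rule ccontr)
    assume "\<not> ?thesis"
    then have "topspace X \<inter> \<Inter>\<N> = {p}"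
      using \<N>(2) p by auto
    then have "gdelta_in X {p}"
      unfolding gdelta_in_def relative_to_def intersection_of_def
      using \<N> by (intro exI[of _ "\<Inter>\<N>"] conjI exI[of _ \<N>]) auto
    with no show False ..
  qed
  have "\<exists>N U. openin X N \<and> p \<in> N \<and> openin X U \<and> x \<in> U \<and> U \<inter> N = {}"
    if x: "x \<in> topspace X - {p}" for x
  proof -
    obtain U N where "openin X U" "openin X N" "x \<in> U" "p \<in> N" "disjnt U N"
      using X(2) p x unfolding Hausdorff_space_def by blast
    then show ?thesis by (auto simp: disjnt_def)
  qed
  then obtain N U where
    N: "\<And>x. x \<in> topspace X - {p} \<Longrightarrow> openin X (N x) \<and> p \<in> N x" and
    U: "\<And>x. x \<in> topspace X - {p} \<Longrightarrow> openin X (U x) \<and> x \<in> U x \<and> U x \<inter> N x = {}"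
    by metis
  have "\<exists>W K. openin X W \<and> x \<in> W \<and> W \<subseteq> K \<and> closedin X K \<and> K \<subseteq> U x"
    if x: "x \<in> topspace X - {p}" for x
    using regular_space_closed_neighbourhood[OF reg, of "U x" x] U[OF x] by metis
  then obtain W K where
    W: "\<And>x. x \<in> topspace X - {p} \<Longrightarrow> openin X (W x) \<and> x \<in> W x \<and> W x \<subseteq> K x" and
    K: "\<And>x. x \<in> topspace X - {p} \<Longrightarrow> closedin X (K x) \<and> K x \<subseteq> U x"
    by metis
  obtain y :: "omega1 \<Rightarrow> 'a" where y: "\<And>a. y a \<in> topspace X - {p}"
    and yN: "\<And>a. \<forall>s\<in>y ` {..<a}. y a \<in> N s"
  proof (rule omega1_recursion[of "topspace X - {p}" "\<lambda>S x. \<forall>s\<in>S. x \<in> N s"])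
    show "\<exists>x\<in>topspace X - {p}. \<forall>s\<in>S. x \<in> N s"
      if "countable S" "S \<subseteq> topspace X - {p}" for S
    proof -
      have "countable (N ` S)" "\<And>M. M \<in> N ` S \<Longrightarrow> openin X M \<and> p \<in> M"
        using that N by auto
      then show ?thesis using other[of "N ` S"] by simp
    qed
  qed blast
  have sep: "y b \<notin> U (y a)" if "a < b" for a b
    using yN[of b] U[OF y[of a]] that by auto
  define E where "E a b \<longleftrightarrow> a < b \<and> y a \<in> W (y b)" for a b
  have ccc: "countable \<A>"
    if \<A>: "\<And>F. F \<in> \<A> \<Longrightarrow> finite F \<and> indep E F"
      "pairwise (\<lambda>F G. \<not> indep E (F \<union> G)) \<A>" for \<A>
  proof (rule ccontr)
    assume unc: "uncountable \<A>"
    have E: "a < b" if "E a b" for a b using that by (simp add: E_def)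
    show False
    proof (rule uncountable_antichain_imp_blocks[OF E unc \<A>])
      fix F :: "omega1 \<Rightarrow> omega1 set" and n
      assume F: "\<And>a. finite (F a)" "\<And>a. card (F a) = n"
        and less: "\<And>a b i j. a < b \<Longrightarrow> i \<in> F a \<Longrightarrow> j \<in> F b \<Longrightarrow> i < j"
        and link: "\<And>a b. a < b \<Longrightarrow> \<exists>i\<in>F a. \<exists>j\<in>F b. E i j"
      have "\<exists>h. bij_betw h {..<n} (F a)" for a
        using ex_bij_betw_nat_finite[OF F(1)[of a]] F(2)[of a] by (simp add: lessThan_atLeast0)
      then obtain e where e: "\<And>a. bij_betw (e a) {..<n} (F a)"
        by metis
      define C where "C b = (\<Union>j\<in>F b. K (y j))" for b
      define D where "D b = topspace X - (\<Union>j\<in>F b. U (y j))" for b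
      show False
      proof (rule countably_tight_no_free_tuples[of X "{..<n}" "\<lambda>a i. y (e a i)" C D])
        show "countably_tight X"
          using X by (rule countable_spread_imp_countably_tight)
        show "closedin X (C b)" for b
          unfolding C_def using F(1) K[OF y] by (intro closedin_Union) auto
        show "closedin X (D b)" for b
          unfolding D_def using U[OF y] by (intro closedin_diff closedin_topspace openin_Union) auto
        show "C b \<inter> D b = {}" for b
          using K[OF y] by (auto simp: C_def D_def)
        show "\<exists>i\<in>{..<n}. y (e a i) \<in> C b" if ab: "a < b" for a b
        proof -
          obtain i j where "i \<in> F a" "j \<in> F b" "E i j" using link[OF ab] by blast
          moreover then obtain k where "k < n" "i = e a k"
            using e[of a] by (auto simp: bij_betw_def)
          ultimately show ?thesis
            using W[OF y[of j]] by (auto simp: C_def E_def)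
        qed
        show "y (e a i) \<in> D b" if "b < a" "i \<in> {..<n}" for a b i
        proof -
          have "e a i \<in> F a" using e[of a] that(2) by (auto simp: bij_betw_def)
          then show ?thesis
            using sep less[OF that(1)] y[of "e a i"] by (auto simp: D_def)
        qed
      qed (use X y in auto)
    qed
  qed
  obtain H where H: "uncountable H" "indep E H"
    by (rule MA_uncountable_indep[of E, OF MA _ ccc]) (auto simp: E_def)
  have "countable H"
  proof (rule countable_spread_discrete_family[OF X(3)])
    show "y a \<in> topspace X" for a using y by blast
    fix a assume a: "a \<in> H"
    show "\<exists>V. openin X V \<and> y a \<in> V \<and> (\<forall>b\<in>H. y b \<in> V \<longrightarrow> b = a)"
    proof (intro exI[of _ "W (y a)"] conjI ballI impI)
      fix b assume b: "b \<in> H" "y b \<in> W (y a)"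
      then have "\<not> b < a" using H(2) a by (auto simp: indep_def E_def)
      moreover have "\<not> a < b" using sep[of a b] b(2) W[OF y[of a]] K[OF y[of a]] by blast
      ultimately show "b = a" by simp
    qed (use W[OF y[of a]] in auto)
  qed
  then show False using H(1) by blast
qed

lemma gdelta_point_nested_base:
  assumes X: "compact_space X" "Hausdorff_space X" and p: "gdelta_in X {p}"
  obtains V :: "nat \<Rightarrow> 'a set" where "\<And>n. openin X (V n)" "\<And>n. p \<in> V n"
    "\<And>n. X closure_of (V (Suc n)) \<subseteq> V n" "(\<Inter>n. V n) = {p}"
    "\<And>U. openin X U \<Longrightarrow> p \<in> U \<Longrightarrow> \<exists>n. V n \<subseteq> U"
proof -
  have reg: "regular_space X"
    using X by (intro compact_Hausdorff_imp_regular_space)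
  obtain N where N: "\<And>n::nat. openin X (N n)" "(\<Inter>n. N n) = {p}"
    using p unfolding gdelta_in_descending by blast
  have pN: "p \<in> N n" for n using N(2) by blast
  have "\<exists>V. \<forall>n. (openin X (V n) \<and> p \<in> V n \<and> V n \<subseteq> N n) \<and> X closure_of (V (Suc n)) \<subseteq> V n"
  proof (rule dependent_nat_choice)
    show "\<exists>V. openin X V \<and> p \<in> V \<and> V \<subseteq> N 0" using N(1) pN by blast
    fix V n assume V: "openin X V \<and> p \<in> V \<and> V \<subseteq> N n"
    have "openin X (V \<inter> N (Suc n))" "p \<in> V \<inter> N (Suc n)" using V N(1) pN by auto
    then obtain W K where W: "openin X W" "closedin X K" "p \<in> W" "W \<subseteq> K" "K \<subseteq> V \<inter> N (Suc n)"
      by (rule regular_space_closed_neighbourhood[OF reg])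
    then have "X closure_of W \<subseteq> K" by (intro closure_of_minimal)
    then show "\<exists>W. (openin X W \<and> p \<in> W \<and> W \<subseteq> N (Suc n)) \<and> X closure_of W \<subseteq> V"
      using W by blast
  qed
  then obtain V where V: "\<And>n. openin X (V n)" "\<And>n. p \<in> V n" "\<And>n. V n \<subseteq> N n"
    "\<And>n. X closure_of (V (Suc n)) \<subseteq> V n" by blast
  have cl: "V n \<subseteq> X closure_of (V n)" for n
    using V(1) by (intro closure_of_subset openin_subset)
  have "(\<Inter>n. V n) \<subseteq> (\<Inter>n. N n)"
    using V(3) by (rule INF_mono')
  then have int: "(\<Inter>n. V n) = {p}"
    using V(2) unfolding N(2) by auto
  show thesis
  proof (rule that[OF V(1,2,4) int])
    fix U assume U: "openin X U" "p \<in> U"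
    show "\<exists>n. V n \<subseteq> U"
    proof (rule ccontr)
      assume no: "\<not> ?thesis"
      have "(\<Inter>n. X closure_of (V n) - U) \<noteq> {}"
      proof (rule compact_space_imp_nest[OF X(1)])
        show "closedin X (X closure_of (V n) - U)" for n
          using U(1) by (intro closedin_diff) auto
        show "X closure_of (V n) - U \<noteq> {}" for n
          using no cl[of n] by blast
        show "decseq (\<lambda>n. X closure_of (V n) - U)"
          unfolding decseq_Suc_iff using V(4) cl by blast
      qed
      then obtain x where "\<And>n. x \<in> X closure_of (V n)" "x \<notin> U" by blast
      then have "x \<in> V n" for n using V(4)[of n] by blast
      then have "x \<in> (\<Inter>n. V n)" by simp
      then have "x = p" unfolding int by simp
      then show False using U(2) \<open>x \<notin> U\<close> by simp
    qed
  qed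
qed

text \<open>
  If the rings \<open>R n\<close> were empty from some \<open>k\<close> on, then \<open>V k = V n\<close> for all \<open>n \<ge> k\<close>, hence
  \<open>V k = {p}\<close>, and \<open>p\<close> would be isolated.
\<close>

lemma gdelta_point_disjoint_local_pi_base:
  assumes X: "compact_space X" "Hausdorff_space X" and p: "gdelta_in X {p}"
  shows "\<exists>\<B>. local_pi_base X p \<B> \<and> pairwise disjnt \<B>"
proof (cases "openin X {p}")
  case True
  then show ?thesis
    by (intro exI[of _ "{{p}}"]) (auto simp: local_pi_base_def)
next
  case False
  show ?thesis
  proof (rule gdelta_point_nested_base[OF X p])
    fix V :: "nat \<Rightarrow> 'a set"
    assume V: "\<And>n. openin X (V n)" "\<And>n. p \<in> V n"
      and cl: "\<And>n. X closure_of (V (Suc n)) \<subseteq> V n" and int: "(\<Inter>n. V n) = {p}"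
      and base: "\<And>U. openin X U \<Longrightarrow> p \<in> U \<Longrightarrow> \<exists>n. V n \<subseteq> U"
    have sub: "V n \<subseteq> X closure_of (V n)" for n
      using V(1) by (intro closure_of_subset openin_subset)
    have dec: "V n \<subseteq> V m" if "m \<le> n" for m n
      by (rule lift_Suc_antimono_le[OF _ that]) (use cl sub in blast)
    define R where "R n = V n - X closure_of (V (Suc n))" for n
    have disj: "disjnt (R m) (R n)" if "m < n" for m n
      using dec[of "Suc m" n] that sub[of "Suc m"] by (auto simp: R_def disjnt_def)
    let ?\<B> = "range R - {{}}"
    have "local_pi_base X p ?\<B>"
      unfolding local_pi_base_def
    proof (intro conjI ballI allI impI)
      show "openin X B" if "B \<in> ?\<B>" for B
        using that V(1) by (auto simp: R_def)
      show "B \<noteq> {}" if "B \<in> ?\<B>" for B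
        using that by blast
      fix M assume "\<exists>U. openin X U \<and> p \<in> U \<and> U \<subseteq> M"
      then obtain k where k: "V k \<subseteq> M" using base by (meson subset_trans)
      have "\<exists>n\<ge>k. R n \<noteq> {}"
      proof (rule ccontr)
        assume "\<not> ?thesis"
        then have empty: "R m = {}" if "k \<le> m" for m using that by blast
        have "V k \<subseteq> V m" if "k \<le> m" for m
          using that
        proof (induction m rule: dec_induct)
          case (step m)
          then have "R m = {}" "R (Suc m) = {}" using empty by auto
          then have "V m \<subseteq> V (Suc m)" using cl[of "Suc m"] cl[of m] by (auto simp: R_def)
          then show ?case using step by blast
        qed simp
        then have "V k \<subseteq> V n" for n
          using dec[of n k] by (cases "k \<le> n") auto
        then have "V k = {p}" using int V(2) by blast
        then show False using False V(1) by metis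
      qed
      then obtain n where "n \<ge> k" "R n \<noteq> {}" by blast
      moreover then have "R n \<subseteq> M" using dec[of k n] k by (auto simp: R_def)
      ultimately show "\<exists>B\<in>?\<B>. B \<subseteq> M" by blast
    qed
    moreover have "pairwise disjnt ?\<B>"
    proof -
      have "disjnt (R m) (R n)" if "R m \<noteq> R n" for m n
        using disj[of m n] disj[of n m] that by (metis disjnt_sym neqE)
      then show ?thesis by (auto simp: pairwise_def)
    qed
    ultimately show ?thesis by blast
  qed
qed

theorem mainTheorem6:
  fixes X :: "'a topology"
  assumes "MA_omega1"
    and "compact_space X" and "Hausdorff_space X"
    and "countable_spread X"
  shows "\<forall>p\<in>topspace X. \<exists>\<B>. local_pi_base X p \<B> \<and> pairwise disjnt \<B>"
proof
  fix p assume "p \<in> topspace X"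
  then have "gdelta_in X {p}"
    using assms by (intro MA_countable_spread_imp_gdelta_point)
  then show "\<exists>\<B>. local_pi_base X p \<B> \<and> pairwise disjnt \<B>"
    using assms by (intro gdelta_point_disjoint_local_pi_base)
qed

end
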